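(* Let $k \in \mathbb{N}$ with $k \geq 2$. For every integer $g \geq 1$ there exists a $k$-system $\Omega(k,g)$ on the closed orientable surface $S_g$ of genus $g$ such that $$|\Omega(k,g)| \geq \binom{g}{1+\lfloor k/2 \rfloor} \quad \text{for every } g \geq 1,$$ and such that, for this fixed $k$ and as a function of $g$, $$|\Omega(k,g)| = \Theta\left(g^{\lfloor (k+1)/2 \rfloor + 1}\right).$$
   Context: $S_g$ denotes the closed orientable surface of genus $g$. A simple closed curve on $S_g$ is essential if it is not homotopically trivial. A $k$-system on a surface is a collection of essential, pairwise non-homotopic simple closed curves such that no two curves in the collection intersect more than $k$ times; here intersections are counted by the geometric intersection number $i(\alpha,\beta)$, the minimum of $|x \cap y|$ over all $x$ homotopic to $\alpha$ and $y$ homotopic to $\beta$. The notation $f = \Theta(h)$, for functions $f,h$ of a natural number variable, means $0 < \lim_{n \to \infty} f(n)/h(n) < \infty$ (in particular, the limit exists). The binomial coefficient $\binom{a}{b}$ is $0$ when $b > a$. *)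

theory Defs
  imports "HOL-Analysis.Analysis" "HOL-Library.Extended_Nat"
begin

section \<open>The closed orientable surface of genus g\<close>

text \<open>
  The standard handlebody of genus g in three-space: a thickened disc with g round holes,
  centred at the points 1, ..., g of the real axis.
\<close>

definition handlebody :: "nat \<Rightarrow> (complex \<times> real) set" where
  "handlebody g =
     (cball 0 (real g + 1) - (\<Union>j\<in>{1..g}. ball (of_nat j) (1/4))) \<times> {-1..1}"

text \<open>
  By the classification of surfaces, the closed orientable surface of genus g is well defined
  up to homeomorphism; the boundary of the handlebody is the model chosen here.
\<close>

definition closed_orientable_surface :: "nat \<Rightarrow> 'a topology \<Rightarrow> bool" where
  "closed_orientable_surface g X \<longleftrightarrow>
     X homeomorphic_space (top_of_set (frontier (handlebody g)))"

section \<open>Simple closed curves and systems of curves\<close>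

abbreviation circle :: "complex topology" where
  "circle \<equiv> top_of_set (sphere 0 1)"

text \<open>
  Curves are unoriented and unparametrized: a simple closed curve is the image of an embedding
  of the circle.
\<close>

definition parametrizes :: "'a topology \<Rightarrow> (complex \<Rightarrow> 'a) \<Rightarrow> 'a set \<Rightarrow> bool" where
  "parametrizes X f \<alpha> \<longleftrightarrow> embedding_map circle X f \<and> f ` sphere 0 1 = \<alpha>"

definition simple_closed_curve :: "'a topology \<Rightarrow> 'a set \<Rightarrow> bool" where
  "simple_closed_curve X \<alpha> \<longleftrightarrow> (\<exists>f. parametrizes X f \<alpha>)"

text \<open>
  Homotopy is free homotopy. As any parametrizations may be used, a homotopy may
  match the two curves with either choice of orientations.
\<close>

definition homotopic_curves :: "'a topology \<Rightarrow> 'a set \<Rightarrow> 'a set \<Rightarrow> bool" where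
  "homotopic_curves X \<alpha> \<beta> \<longleftrightarrow>
     (\<exists>f g. parametrizes X f \<alpha> \<and> parametrizes X g \<beta> \<and>
            homotopic_with (\<lambda>_. True) circle X f g)"

definition homotopically_trivial :: "'a topology \<Rightarrow> 'a set \<Rightarrow> bool" where
  "homotopically_trivial X \<alpha> \<longleftrightarrow>
     (\<exists>f c. parametrizes X f \<alpha> \<and> homotopic_with (\<lambda>_. True) circle X f (\<lambda>_. c))"

definition essential :: "'a topology \<Rightarrow> 'a set \<Rightarrow> bool" where
  "essential X \<alpha> \<longleftrightarrow> \<not> homotopically_trivial X \<alpha>"

text \<open>
  Number of elements with value infinity on infinite sets, where \<open>card\<close> would be 0:
  representatives with infinite intersection must not contribute to the minimum below.
\<close>

definition ecard :: "'a set \<Rightarrow> enat" where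
  "ecard A = (if finite A then enat (card A) else \<infinity>)"

text \<open>
  The representatives range over simple closed curves only (this is part of
  \<open>homotopic_curves\<close>). Infima of nonempty sets in \<open>enat\<close> are attained.
\<close>

definition geometric_intersection :: "'a topology \<Rightarrow> 'a set \<Rightarrow> 'a set \<Rightarrow> enat" where
  "geometric_intersection X \<alpha> \<beta> =
     Inf {ecard (x \<inter> y) | x y. homotopic_curves X x \<alpha> \<and> homotopic_curves X y \<beta>}"

definition k_system :: "nat \<Rightarrow> 'a topology \<Rightarrow> 'a set set \<Rightarrow> bool" where
  "k_system k X \<Omega> \<longleftrightarrow>
     (\<forall>\<alpha>\<in>\<Omega>. simple_closed_curve X \<alpha> \<and> essential X \<alpha>) \<and>
     pairwise (\<lambda>\<alpha> \<beta>. \<not> homotopic_curves X \<alpha> \<beta>) \<Omega> \<and>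
     pairwise (\<lambda>\<alpha> \<beta>. geometric_intersection X \<alpha> \<beta> \<le> enat k) \<Omega>"

section \<open>Order of growth\<close>

text \<open>Stronger than the Landau symbol of the library: the quotient has to converge.\<close>

definition is_Theta :: "(nat \<Rightarrow> real) \<Rightarrow> (nat \<Rightarrow> real) \<Rightarrow> bool" where
  "is_Theta f h \<longleftrightarrow> (\<exists>c>0. (\<lambda>n. f n / h n) \<longlonglongrightarrow> c)"

end

(*
  All curves lie in the top face of the handlebody, a disc with g holes on the real axis, and
  bound regions between two graphs over the x-axis.  For a set T of t gaps between the holes, the
  upper graph follows a monotone squashing of a polynomial of degree t with simple roots exactly at
  the gaps in T and a leading coefficient that depends only on t.  Two such polynomials differ by
  one of degree below t, so two upper graphs meet at most t - 1 times; the lower graphs are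
  parabolas with a common leading coefficient and meet at most once, and upper and lower graphs do
  not meet.  The curve for T encloses the holes that are followed by an odd number of gaps in T, and
  the set of enclosed holes is a homotopy invariant in the surface, because the projection to the
  plane misses the centres of the holes.  With t = (k + 1) div 2 + 1, which is at most k for k >= 2,
  this gives exactly (g + 1) choose t curves.
*)
theory Submission
  imports Defs
begin

section \<open>Enclosed points as a homotopy invariant\<close>

text \<open>The Borsuk map, in the form used by
  \<open>Borsuk_map_essential_bounded_component\<close>.\<close>

definition radial :: "complex \<Rightarrow> complex \<Rightarrow> complex" where
  "radial z w = inverse (norm (w - z)) *\<^sub>R (w - z)"

lemma continuous_map_radial:
  "continuous_map (top_of_set (- {z})) (top_of_set (sphere 0 1)) (radial z)"
  unfolding radial_def
  by (auto simp: image_subset_iff Pi_iff intro!: continuous_intros)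

lemma embedding_map_imp_continuous_inj:
  assumes "embedding_map X Y f"
  shows "continuous_map X Y f" "inj_on f (topspace X)"
  using assms
  by (auto simp: embedding_map_def homeomorphic_eq_everything_map continuous_map_in_subtopology)

text \<open>
  By Borsuk's theorem, lying inside a compact set is detected by the radial projection from the
  point being essential, and this can be read off a parametrization up to homotopy.
\<close>

lemma parametrized_inside_iff:
  fixes z :: complex
  assumes q: "continuous_map X (top_of_set (- {z})) q" and inj: "inj_on q \<alpha>"
    and f: "parametrizes X f \<alpha>"
  shows "z \<in> inside (q ` \<alpha>) \<longleftrightarrow>
    \<not> (\<exists>c. homotopic_with (\<lambda>_. True) circle circle (radial z \<circ> (q \<circ> f)) (\<lambda>_. c))"
proof -
  let ?S = "q ` \<alpha>"
  have fim: "f ` sphere 0 1 = \<alpha>" and emb: "embedding_map circle X f"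
    using f by (auto simp: parametrizes_def)
  have fc: "continuous_map circle X f"
    using emb by (rule embedding_map_imp_continuous_inj)
  have injf: "inj_on f (sphere 0 1)"
    using embedding_map_imp_continuous_inj(2)[OF emb] by simp
  have qfc: "continuous_map circle (top_of_set (- {z})) (q \<circ> f)"
    using fc q by (rule continuous_map_compose)
  then have cont: "continuous_on (sphere 0 1) (q \<circ> f)" and zS: "z \<notin> ?S"
    using fim by auto
  have S: "(q \<circ> f) ` sphere 0 1 = ?S"
    using fim by (metis image_comp)
  have injqf: "inj_on (q \<circ> f) (sphere 0 1)"
    using comp_inj_on[OF injf] inj fim by simp
  have comp: "compact ?S"
    using compact_continuous_image[OF cont] S by simp
  \<comment> \<open>The circle is compact, so the injective map \<open>q \<circ> f\<close> is a
    homeomorphism onto its image. Composing with it and with its inverse \<open>r\<close> carries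
    null-homotopies both ways.\<close>
  obtain r where r: "homeomorphism (sphere 0 1) ?S (q \<circ> f) r"
    using homeomorphism_compact[OF _ cont S injqf] by auto
  have c1: "continuous_map circle (top_of_set ?S) (q \<circ> f)"
    using cont S by auto
  have c2: "continuous_map (top_of_set ?S) circle r"
    using r by (auto simp: homeomorphism_def)
  have "(\<exists>c. homotopic_with (\<lambda>_. True) (top_of_set ?S) circle (radial z) (\<lambda>_. c)) \<longleftrightarrow>
        (\<exists>c. homotopic_with (\<lambda>_. True) circle circle (radial z \<circ> (q \<circ> f)) (\<lambda>_. c))"
  proof (intro iffI; elim exE)
    fix c assume "homotopic_with (\<lambda>_. True) (top_of_set ?S) circle (radial z) (\<lambda>_. c)"
    from homotopic_with_compose_continuous_map_right[OF this c1]
    have "homotopic_with (\<lambda>_. True) circle circle (radial z \<circ> (q \<circ> f)) ((\<lambda>_. c) \<circ> (q \<circ> f))"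
      by simp
    then show "\<exists>c. homotopic_with (\<lambda>_. True) circle circle (radial z \<circ> (q \<circ> f)) (\<lambda>_. c)"
      by (auto simp: comp_def)
  next
    fix c assume "homotopic_with (\<lambda>_. True) circle circle (radial z \<circ> (q \<circ> f)) (\<lambda>_. c)"
    from homotopic_with_compose_continuous_map_right[OF this c2]
    have "homotopic_with (\<lambda>_. True) (top_of_set ?S) circle (radial z \<circ> (q \<circ> f) \<circ> r) ((\<lambda>_. c) \<circ> r)"
      by auto
    then have "homotopic_with (\<lambda>_. True) (top_of_set ?S) circle (radial z) (\<lambda>_. c)"
      by (rule homotopic_with_eq) (use r in \<open>auto simp: homeomorphism_def\<close>)
    then show "\<exists>c. homotopic_with (\<lambda>_. True) (top_of_set ?S) circle (radial z) (\<lambda>_. c)" ..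
  qed
  moreover have "z \<in> inside ?S \<longleftrightarrow> bounded (connected_component_set (- ?S) z)"
    using zS by (simp add: inside_def)
  ultimately show ?thesis
    using Borsuk_map_essential_bounded_component[OF comp zS] by (simp add: radial_def[abs_def])
qed

text \<open>Composed with \<open>radial z \<circ> q\<close>, a homotopy of curves becomes a homotopy
  of circle maps, and homotopic circle maps are null-homotopic together. The loops in between may
  cross themselves in the plane.\<close>

lemma homotopic_curves_inside_iff:
  fixes z :: complex
  assumes q: "continuous_map X (top_of_set (- {z})) q"
    and inj: "inj_on q \<alpha>" "inj_on q \<beta>" and hom: "homotopic_curves X \<alpha> \<beta>"
  shows "z \<in> inside (q ` \<alpha>) \<longleftrightarrow> z \<in> inside (q ` \<beta>)"
proof -
  obtain f g where f: "parametrizes X f \<alpha>" and g: "parametrizes X g \<beta>"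
    and fg: "homotopic_with (\<lambda>_. True) circle X f g"
    using hom by (auto simp: homotopic_curves_def)
  have "continuous_map X circle (radial z \<circ> q)"
    using q continuous_map_radial by (rule continuous_map_compose)
  from homotopic_with_compose_continuous_map_left[OF fg this]
  have H: "homotopic_with (\<lambda>_. True) circle circle (radial z \<circ> (q \<circ> f)) (radial z \<circ> (q \<circ> g))"
    by (simp add: comp_assoc)
  show ?thesis
    unfolding parametrized_inside_iff[OF q inj(1) f] parametrized_inside_iff[OF q inj(2) g]
    using H by (metis homotopic_with_symD homotopic_with_trans)
qed

text \<open>\<open>q\<close> sends the whole contraction into the plane without \<open>z\<close>, so
  the radial projection contracts as well.\<close>

lemma homotopically_trivial_not_inside:
  fixes z :: complex
  assumes q: "continuous_map X (top_of_set (- {z})) q"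
    and inj: "inj_on q \<alpha>" and triv: "homotopically_trivial X \<alpha>"
  shows "z \<notin> inside (q ` \<alpha>)"
proof -
  obtain f c where f: "parametrizes X f \<alpha>" and fc: "homotopic_with (\<lambda>_. True) circle X f (\<lambda>_. c)"
    using triv by (auto simp: homotopically_trivial_def)
  have "continuous_map X circle (radial z \<circ> q)"
    using q continuous_map_radial by (rule continuous_map_compose)
  from homotopic_with_compose_continuous_map_left[OF fc this]
  have "homotopic_with (\<lambda>_. True) circle circle (radial z \<circ> (q \<circ> f)) (\<lambda>_. radial z (q c))"
    by (simp add: comp_def)
  then show ?thesis
    unfolding parametrized_inside_iff[OF q inj f] by blast
qed

lemma homotopic_curves_refl:
  assumes "simple_closed_curve X \<alpha>" shows "homotopic_curves X \<alpha> \<alpha>"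
proof -
  obtain f where f: "parametrizes X f \<alpha>" using assms by (auto simp: simple_closed_curve_def)
  then have "continuous_map circle X f"
    by (auto simp: parametrizes_def dest: embedding_map_imp_continuous_inj)
  then have "homotopic_with (\<lambda>_. True) circle X f f" by (simp add: homotopic_with_refl)
  with f show ?thesis unfolding homotopic_curves_def by blast
qed

lemma geometric_intersection_le_ecard:
  assumes "simple_closed_curve X \<alpha>" "simple_closed_curve X \<beta>"
  shows "geometric_intersection X \<alpha> \<beta> \<le> ecard (\<alpha> \<inter> \<beta>)"
  unfolding geometric_intersection_def
  using homotopic_curves_refl[OF assms(1)] homotopic_curves_refl[OF assms(2)]
  by (intro Inf_lower) auto

section \<open>Closed curves bounded by two graphs\<close>

definition graph_curve :: "(real \<Rightarrow> real) \<Rightarrow> (real \<Rightarrow> real) \<Rightarrow> real \<Rightarrow> real \<Rightarrow> complex set" where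
  "graph_curve U L l r = {z. l \<le> Re z \<and> Re z \<le> r \<and> (Im z = U (Re z) \<or> Im z = L (Re z))}"

text \<open>The circle is projected to its horizontal diameter, which is stretched to
  \<open>[l, r]\<close>; the upper semicircle goes to the graph of \<open>U\<close>, the lower one
  to that of \<open>L\<close>.\<close>

lemma graph_curve_parametrization:
  assumes U: "continuous_on UNIV U" and L: "continuous_on UNIV L"
    and lr: "l < r" and ends: "U l = L l" "U r = L r"
    and less: "\<And>x. l < x \<Longrightarrow> x < r \<Longrightarrow> L x < U x"
  obtains f :: "complex \<Rightarrow> complex" where "continuous_on (sphere 0 1) f"
    "inj_on f (sphere 0 1)" "f ` sphere 0 1 = graph_curve U L l r"
proof -
  define X where "X e = (l + r) / 2 + (r - l) / 2 * Re e" for e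
  define f where "f e = Complex (X e) (if Im e \<le> 0 then L (X e) else U (X e))" for e
  have sph: "(Re e)\<^sup>2 + (Im e)\<^sup>2 = 1" if "e \<in> sphere 0 1" for e
    using that by (simp add: cmod_def)
  have Xr: "l \<le> X e \<and> X e \<le> r" if "e \<in> sphere 0 1" for e
  proof -
    have "\<bar>Re e\<bar> \<le> 1" using abs_Re_le_cmod[of e] that by simp
    then have "(r - l) / 2 * \<bar>Re e\<bar> \<le> (r - l) / 2 * 1"
      using lr by (intro mult_left_mono) auto
    then have "\<bar>(r - l) / 2 * Re e\<bar> \<le> (r - l) / 2"
      using lr by (simp add: abs_mult)
    then show ?thesis unfolding X_def abs_le_iff by argo
  qed
  have endpt: "L (X e) = U (X e)" if "e \<in> sphere 0 1" "Im e = 0" for e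
  proof -
    have "Re e = 1 \<or> Re e = -1"
      using sph[OF that(1)] that(2) by (simp add: power2_eq_1_iff)
    then have "X e = r \<or> X e = l" by (auto simp: X_def field_simps)
    with ends show ?thesis by auto
  qed
  have Xc: "continuous_on A X" for A
    unfolding X_def by (intro continuous_intros)
  have UX: "continuous_on A (\<lambda>e. U (X e))" "continuous_on A (\<lambda>e. L (X e))" for A
    by (rule continuous_on_compose2[OF U Xc] continuous_on_compose2[OF L Xc]; simp)+
  have "continuous_on (sphere 0 1) (\<lambda>e. if Im e \<le> 0 then L (X e) else U (X e))"
    by (rule continuous_on_cases_le) (auto intro!: UX endpt continuous_intros)
  then have "continuous_on (sphere 0 1) f"
    unfolding f_def Complex_eq by (intro continuous_intros Xc)
  moreover have "inj_on f (sphere 0 1)"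
  proof (rule inj_onI)
    \<comment> \<open>Above the real axis the abscissa lies strictly between \<open>l\<close> and
      \<open>r\<close>, where the graphs are apart, so the value tells which semicircle the point
      comes from.\<close>
    have *: "L (X e) \<noteq> U (X e)" if "e \<in> sphere 0 1" "Im e > 0" for e
    proof -
      have "(Re e)\<^sup>2 < 1" using sph[OF that(1)] zero_less_power[OF that(2), of 2] by linarith
      then have "\<bar>Re e\<bar> < 1" by (simp add: abs_square_less_1)
      then have "(r - l) * \<bar>Re e\<bar> < (r - l) * 1"
        using lr by (intro mult_strict_left_mono) auto
      then have "\<bar>(r - l) * Re e\<bar> < r - l" using lr by (simp add: abs_mult)
      then have "l < X e" "X e < r" unfolding X_def by (auto simp: field_simps abs_less_iff)
      then show ?thesis using less by force
    qed
    fix e e' :: complex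
    assume e: "e \<in> sphere 0 1" and e': "e' \<in> sphere 0 1" and eq: "f e = f e'"
    have Re: "Re e = Re e'" using eq lr by (auto simp: f_def X_def)
    then have XX: "X e = X e'" by (simp add: X_def)
    have "(Im e)\<^sup>2 = (Im e')\<^sup>2" using sph[OF e] sph[OF e'] Re by simp
    then have "Im e = Im e' \<or> Im e = - Im e'" by (simp add: power2_eq_iff)
    moreover have "Im e \<le> 0 \<longleftrightarrow> Im e' \<le> 0"
      using eq *[OF e] *[OF e'] XX by (auto simp: f_def not_le split: if_splits)
    ultimately show "e = e'" using Re by (auto simp: complex_eq_iff)
  qed
  moreover have "f ` sphere 0 1 = graph_curve U L l r"
  proof (intro equalityI subsetI)
    fix z assume "z \<in> f ` sphere 0 1"
    then show "z \<in> graph_curve U L l r"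
      using Xr by (auto simp: f_def graph_curve_def)
  next
    fix z assume "z \<in> graph_curve U L l r"
    then obtain x y where z: "z = Complex x y" and x: "l \<le> x" "x \<le> r" and y: "y = U x \<or> y = L x"
      by (metis (mono_tags, lifting) complex_surj graph_curve_def mem_Collect_eq)
    define u where "u = (2 * x - l - r) / (r - l)"
    have "\<bar>u\<bar> \<le> 1" using x lr unfolding u_def by (auto simp: abs_le_iff field_simps)
    then have u2: "u\<^sup>2 \<le> 1" by (simp add: abs_square_le_1)
    define e where "e s = Complex u (s * sqrt (1 - u\<^sup>2))" for s
    have es: "e s \<in> sphere 0 1" if "s\<^sup>2 = 1" for s
      using that u2 by (simp add: e_def cmod_def power_mult_distrib)
    have Xe: "X (e s) = x" for s
      using lr by (simp add: X_def e_def u_def field_simps)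
    from y show "z \<in> f ` sphere 0 1"
    proof
      assume "y = L x"
      then have "f (e (-1)) = z" using u2 by (simp add: f_def Xe z) (simp add: e_def)
      then show ?thesis using es[of "-1"] by force
    next
      assume yU: "y = U x"
      have "f (e 1) = z"
      \<comment> \<open>At an end point \<open>e 1\<close> is real and \<open>f\<close> takes the
        branch of \<open>L\<close>, which agrees with \<open>U\<close> there.\<close>
      proof (cases "Im (e 1) \<le> 0")
        case True
        then have "Im (e 1) = 0" using u2 by (simp add: e_def)
        from endpt[OF es this] Xe[of 1] yU z True show ?thesis by (simp add: f_def)
      qed (simp add: f_def Xe z yU)
      then show ?thesis using es[of 1] by force
    qed
  qed
  ultimately show ?thesis by (rule that)
qed

text \<open>The function \<open>F\<close> of the proof is continuous, vanishes exactly on the curve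
  and is negative exactly between the graphs. It keeps its sign on a component of the complement,
  and the negative region is bounded because \<open>out\<close> reverses the graphs beyond
  \<open>l\<close> and \<open>r\<close>.\<close>

lemma graph_curve_inside:
  assumes U: "continuous_on UNIV U" and L: "continuous_on UNIV L"
    and sub: "\<And>x. l \<le> x \<Longrightarrow> x \<le> r \<Longrightarrow> L x \<le> U x"
    and out: "\<And>x. x < l \<or> r < x \<Longrightarrow> U x < L x"
    and y: "L x < y" "y < U x"
  shows "Complex x y \<in> inside (graph_curve U L l r)"
proof -
  let ?S = "graph_curve U L l r"
  define F where "F z = max (Im z - U (Re z)) (L (Re z) - Im z)" for z
  have F0: "F z = 0 \<longleftrightarrow> z \<in> ?S" for z
  proof (cases "l \<le> Re z \<and> Re z \<le> r")
    case True
    then have "L (Re z) \<le> U (Re z)" using sub by blast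
    with True show ?thesis by (auto simp: F_def graph_curve_def max_def)
  next
    case False
    then show ?thesis using out[of "Re z"] by (auto simp: F_def graph_curve_def max_def)
  qed
  let ?C = "connected_component_set (- ?S) (Complex x y)"
  have z: "F (Complex x y) < 0" using y by (simp add: F_def)
  then have zS: "Complex x y \<notin> ?S" using F0 by force
  have Fc: "continuous_on A F" for A
    unfolding F_def
    by (intro continuous_intros continuous_on_compose2[OF U] continuous_on_compose2[OF L]) auto
  have "connected (F ` ?C)" by (rule connected_continuous_image[OF Fc]) simp
  moreover have nz: "F w \<noteq> 0" if "w \<in> ?C" for w
    using F0 connected_component_subset[of "- ?S" "Complex x y"] that by auto
  moreover have "F (Complex x y) \<in> F ` ?C"
    using zS by (simp add: connected_component_refl)
  ultimately have neg: "F w < 0" if "w \<in> ?C" for w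
    using that z connectedD_interval[of "F ` ?C" "F (Complex x y)" "F w" 0] nz by force
  have "bounded (U ` {l..r})" "bounded (L ` {l..r})"
    using U L by (auto intro!: compact_imp_bounded compact_continuous_image elim: continuous_on_subset)
  then obtain u v where u: "\<And>x. x \<in> {l..r} \<Longrightarrow> \<bar>U x\<bar> \<le> u" and v: "\<And>x. x \<in> {l..r} \<Longrightarrow> \<bar>L x\<bar> \<le> v"
    unfolding bounded_iff by (metis imageI real_norm_def)
  have "?C \<subseteq> cbox (Complex l (- v)) (Complex r u)"
  proof
    fix w assume "w \<in> ?C"
    from neg[OF this] have w: "Im w < U (Re w)" "L (Re w) < Im w" by (auto simp: F_def)
    then have "Re w \<in> {l..r}" using out[of "Re w"] by force
    with u[of "Re w"] v[of "Re w"] w show "w \<in> cbox (Complex l (- v)) (Complex r u)"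
      by (auto simp: in_cbox_complex_iff)
  qed
  then have "bounded ?C" by (rule bounded_subset[OF bounded_cbox])
  with zS show ?thesis by (simp add: inside_def)
qed

text \<open>The vertical ray upwards from the point is unbounded and misses the curve.\<close>

lemma graph_curve_not_inside:
  assumes "U x < y" "L x < y"
  shows "Complex x y \<notin> inside (graph_curve U L l r)"
proof
  let ?S = "graph_curve U L l r"
  assume "Complex x y \<in> inside ?S"
  then have bd: "bounded (connected_component_set (- ?S) (Complex x y))" by (simp add: inside_def)
  define R where "R = Complex x ` {y..}"
  have "continuous_on {y..} (Complex x)" unfolding Complex_eq by (intro continuous_intros)
  then have "connected R" unfolding R_def by (rule connected_continuous_image) simp
  moreover have "R \<subseteq> - ?S" using assms by (auto simp: R_def graph_curve_def)
  ultimately have "R \<subseteq> connected_component_set (- ?S) (Complex x y)"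
    by (intro connected_component_maximal) (auto simp: R_def)
  then obtain B where B: "\<And>w. w \<in> R \<Longrightarrow> cmod w \<le> B"
    using bd unfolding bounded_iff by blast
  have "Complex x (max y (B + 1)) \<in> R" by (simp add: R_def)
  with B[of "Complex x (max y (B + 1))"] abs_Im_le_cmod[of "Complex x (max y (B + 1))"]
  show False by auto
qed

section \<open>Squashing the real line into a bounded interval\<close>

definition squash :: "real \<Rightarrow> real" where
  "squash v = v / (2 * (1 + \<bar>v\<bar>))"

lemma abs_squash: "\<bar>squash v\<bar> < 1/2"
  by (simp add: squash_def abs_mult abs_divide field_simps)

lemma squash_bounds: "-1/2 < squash v" "squash v < 1/2"
  using abs_squash[of v] by (auto simp: abs_less_iff)

lemma squash_inject [simp]: "squash v = squash w \<longleftrightarrow> v = w"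
proof
  assume "squash v = squash w"
  then have eq: "v * (1 + \<bar>w\<bar>) = w * (1 + \<bar>v\<bar>)"
    by (simp add: squash_def field_simps)
  then have "v + v * \<bar>w\<bar> = w + w * \<bar>v\<bar>" by (simp add: algebra_simps)
  \<comment> \<open>Equal signs give equal products; if one value is negative and the other is not,
    the two sides of \<open>eq\<close> have different signs.\<close>
  moreover have "v * \<bar>w\<bar> = w * \<bar>v\<bar>"
  proof (cases "0 \<le> v \<longleftrightarrow> 0 \<le> w")
    case True then show ?thesis by (auto simp: abs_if)
  next
    case False
    then have "(v \<ge> 0 \<and> w < 0) \<or> (v < 0 \<and> w \<ge> 0)" by auto
    then show ?thesis
    proof
      assume *: "v \<ge> 0 \<and> w < 0"
      then have "v * (1 + \<bar>w\<bar>) \<ge> 0" "w * (1 + \<bar>v\<bar>) < 0" by (auto intro: mult_neg_pos)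
      with eq show ?thesis by simp
    next
      assume *: "v < 0 \<and> w \<ge> 0"
      then have "w * (1 + \<bar>v\<bar>) \<ge> 0" "v * (1 + \<bar>w\<bar>) < 0" by (auto intro: mult_neg_pos)
      with eq show ?thesis by simp
    qed
  qed
  ultimately show "v = w" by simp
qed simp

lemma squash_pos_iff: "0 < squash v \<longleftrightarrow> 0 < v"
  and squash_neg_iff: "squash v < 0 \<longleftrightarrow> v < 0"
  by (auto simp: squash_def zero_less_divide_iff divide_less_0_iff)

text \<open>The bound 1/4 is the radius of the holes, so a graph squashed from values of absolute
  value at least 1 clears a hole.\<close>

lemma abs_squash_ge: "1 \<le> \<bar>v\<bar> \<Longrightarrow> 1/4 \<le> \<bar>squash v\<bar>"
  by (simp add: squash_def abs_mult abs_divide field_simps)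

lemma continuous_on_squash: "continuous_on A squash"
  unfolding squash_def by (intro continuous_intros) auto

section \<open>Upper graphs and lower parabolas\<close>

definition clamp_to :: "real \<Rightarrow> real \<Rightarrow> real \<Rightarrow> real" where
  "clamp_to a b x = max a (min b x)"

definition upper :: "real \<Rightarrow> real \<Rightarrow> (real \<Rightarrow> real) \<Rightarrow> real \<Rightarrow> real" where
  "upper a b p x = squash (p (clamp_to a b x)) - 4 * \<bar>x - clamp_to a b x\<bar>"

text \<open>
  Beyond \<open>[a, b]\<close> the upper graph falls with slope 4 until it reaches height -1/2 at the end
  points below.  This height separates the upper graphs from the lower ones, and the end points are
  distinct for functions with distinct values at \<open>a\<close> and at \<open>b\<close>.
\<close>

definition left :: "real \<Rightarrow> (real \<Rightarrow> real) \<Rightarrow> real" where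
  "left a p = a - (squash (p a) + 1/2) / 4"

definition right :: "real \<Rightarrow> (real \<Rightarrow> real) \<Rightarrow> real" where
  "right b p = b + (squash (p b) + 1/2) / 4"

text \<open>Factored over the end points of the upper graph, the parabola closes that graph up at
  height -1/2. The shared leading coefficient makes the difference of two such parabolas
  affine.\<close>

definition lower :: "real \<Rightarrow> real \<Rightarrow> real \<Rightarrow> (real \<Rightarrow> real) \<Rightarrow> real \<Rightarrow> real" where
  "lower \<mu> a b p x = \<mu> * ((x - left a p) * (x - right b p)) - 1/2"

definition hull_curve :: "real \<Rightarrow> real \<Rightarrow> real \<Rightarrow> (real \<Rightarrow> real) \<Rightarrow> complex set" where
  "hull_curve \<mu> a b p = graph_curve (upper a b p) (lower \<mu> a b p) (left a p) (right b p)"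

lemma left_bounds: "a - 1/4 < left a p" "left a p < a"
  using squash_bounds[of "p a"] by (auto simp: left_def field_simps)

lemma right_bounds: "b < right b p" "right b p < b + 1/4"
  using squash_bounds[of "p b"] by (auto simp: right_def field_simps)

lemma left_inject [simp]: "left a p = left a q \<longleftrightarrow> p a = q a"
  by (simp add: left_def)

lemma right_inject [simp]: "right b p = right b q \<longleftrightarrow> p b = q b"
  by (simp add: right_def)

lemma upper_inside [simp]: "a \<le> x \<Longrightarrow> x \<le> b \<Longrightarrow> upper a b p x = squash (p x)"
  by (simp add: upper_def clamp_to_def)

lemma upper_left: "a \<le> b \<Longrightarrow> x \<le> a \<Longrightarrow> upper a b p x = 4 * (x - left a p) - 1/2"
  by (simp add: upper_def clamp_to_def left_def field_simps)

lemma upper_right: "a \<le> b \<Longrightarrow> b \<le> x \<Longrightarrow> upper a b p x = 4 * (right b p - x) - 1/2"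
  by (simp add: upper_def clamp_to_def right_def field_simps)

lemma continuous_on_upper:
  assumes "continuous_on UNIV p" shows "continuous_on UNIV (upper a b p)"
proof -
  have c: "continuous_on UNIV (clamp_to a b)"
    unfolding clamp_to_def by (intro continuous_intros)
  have "continuous_on UNIV (\<lambda>x. squash (p (clamp_to a b x)))"
    by (rule continuous_on_compose2[OF continuous_on_squash continuous_on_compose2[OF assms c]]) auto
  then show ?thesis unfolding upper_def by (intro continuous_intros c)
qed

lemma continuous_on_lower: "continuous_on UNIV (lower \<mu> a b p)"
  unfolding lower_def by (intro continuous_intros)

lemma upper_less_half: "upper a b p x < 1/2"
  unfolding upper_def by (rule le_less_trans[OF _ squash_bounds(2)[of "p (clamp_to a b x)"]]) simp

lemma upper_gt:
  assumes "a < b" "left a p < x" "x < right b p" shows "-1/2 < upper a b p x"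
proof -
  consider "x \<le> a" | "a \<le> x" "x \<le> b" | "b \<le> x" by linarith
  then show ?thesis
  proof cases
    case 1 then show ?thesis using assms upper_left[of a b x p] by simp
  next
    case 2 then show ?thesis using squash_bounds(1)[of "p x"] by simp
  next
    case 3 then show ?thesis using assms upper_right[of a b x p] by simp
  qed
qed

lemma upper_ends:
  assumes "a < b"
  shows "upper a b p (left a p) = -1/2" "upper a b p (right b p) = -1/2"
  using assms left_bounds(2)[of a p] right_bounds(1)[of b p] by (auto simp: upper_left upper_right)

lemma upper_ge:
  assumes "a < b" "left a p \<le> x" "x \<le> right b p"
  shows "-1/2 \<le> upper a b p x" "upper a b p x = -1/2 \<Longrightarrow> x = left a p \<or> x = right b p"
proof -
  have "x = left a p \<or> x = right b p \<or> -1/2 < upper a b p x"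
    using upper_gt[OF assms(1), of p x] assms(2,3) by linarith
  then show "-1/2 \<le> upper a b p x" "upper a b p x = -1/2 \<Longrightarrow> x = left a p \<or> x = right b p"
    using upper_ends[OF assms(1), of p] by auto
qed

lemma upper_out:
  assumes "a < b" "x < left a p \<or> right b p < x" shows "upper a b p x < -1/2"
  using assms left_bounds(2)[of a p] right_bounds(1)[of b p] by (auto simp: upper_left upper_right)

lemma lower_lt:
  assumes "0 < \<mu>" "left a p < x" "x < right b p" shows "lower \<mu> a b p x < -1/2"
proof -
  have "(x - left a p) * (x - right b p) < 0" using assms by (intro mult_pos_neg) auto
  then have "\<mu> * ((x - left a p) * (x - right b p)) < 0" by (rule mult_pos_neg[OF assms(1)])
  then show ?thesis by (simp add: lower_def)
qed

lemma lower_ends: "lower \<mu> a b p (left a p) = -1/2" "lower \<mu> a b p (right b p) = -1/2"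
  by (auto simp: lower_def)

lemma lower_le:
  assumes "0 < \<mu>" "left a p \<le> x" "x \<le> right b p"
  shows "lower \<mu> a b p x \<le> -1/2" "lower \<mu> a b p x = -1/2 \<Longrightarrow> x = left a p \<or> x = right b p"
proof -
  have "x = left a p \<or> x = right b p \<or> lower \<mu> a b p x < -1/2"
    using lower_lt[OF assms(1), of a p x b] assms(2,3) by linarith
  then show "lower \<mu> a b p x \<le> -1/2" "lower \<mu> a b p x = -1/2 \<Longrightarrow> x = left a p \<or> x = right b p"
    using lower_ends[of \<mu> a b p] by auto
qed

text \<open>Together with \<open>upper_out\<close> this gives the reversed order beyond the end
  points that \<open>graph_curve_inside\<close> requires.\<close>

lemma lower_out:
  assumes "0 < \<mu>" "a < b" "x < left a p \<or> right b p < x" shows "-1/2 < lower \<mu> a b p x"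
proof -
  have "0 < (x - left a p) * (x - right b p)"
    using assms left_bounds(2)[of a p] right_bounds(1)[of b p] by (auto simp: zero_less_mult_iff)
  then have "0 < \<mu> * ((x - left a p) * (x - right b p))" by (rule mult_pos_pos[OF assms(1)])
  then show ?thesis by (simp add: lower_def)
qed

section \<open>Enclosed points and intersections of hull curves\<close>

lemma hull_curve_parametrization:
  assumes "continuous_on UNIV p" "0 < \<mu>" "a < b"
  obtains f :: "complex \<Rightarrow> complex" where "continuous_on (sphere 0 1) f"
    "inj_on f (sphere 0 1)" "f ` sphere 0 1 = hull_curve \<mu> a b p"
proof -
  have lr: "left a p < right b p"
    using left_bounds(2)[of a p] right_bounds(1)[of b p] assms by linarith
  have ends: "upper a b p (left a p) = lower \<mu> a b p (left a p)"
    "upper a b p (right b p) = lower \<mu> a b p (right b p)"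
    using upper_ends[OF assms(3)] lower_ends by simp_all
  have less: "lower \<mu> a b p x < upper a b p x" if "left a p < x" "x < right b p" for x
    using upper_gt[OF assms(3) that] lower_lt[OF assms(2) that] by linarith
  show ?thesis
    by (rule graph_curve_parametrization[OF continuous_on_upper[OF assms(1)] continuous_on_lower lr ends less])
       (assumption, assumption, unfold hull_curve_def[symmetric], rule that)
qed

text \<open>The lower graph runs below height 0, so the sign of \<open>squash (p x)\<close> decides:
  if positive, the point lies between the graphs; if negative, the ray upwards escapes.\<close>

lemma hull_curve_inside_iff:
  assumes "continuous_on UNIV p" "0 < \<mu>" "a < b" "a \<le> x" "x \<le> b" "p x \<noteq> 0"
  shows "of_real x \<in> inside (hull_curve \<mu> a b p) \<longleftrightarrow> 0 < p x"
proof -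
  have x: "left a p < x" "x < right b p"
    using left_bounds(2)[of a p] right_bounds(1)[of b p] assms by linarith+
  have lo: "lower \<mu> a b p x < 0" using lower_lt[OF assms(2) x] by simp
  have up: "upper a b p x = squash (p x)" using assms by simp
  have cx: "of_real x = Complex x 0" by (simp add: complex_eq_iff)
  show ?thesis
  proof (cases "0 < p x")
    case True
    have le: "lower \<mu> a b p y \<le> upper a b p y" if "left a p \<le> y" "y \<le> right b p" for y
      using upper_ge(1)[OF assms(3) that] lower_le(1)[OF assms(2) that] by linarith
    have out: "upper a b p y < lower \<mu> a b p y" if "y < left a p \<or> right b p < y" for y
      using upper_out[OF assms(3) that] lower_out[OF assms(2,3) that] by linarith
    have "Complex x 0 \<in> inside (graph_curve (upper a b p) (lower \<mu> a b p) (left a p) (right b p))"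
      by (rule graph_curve_inside[OF continuous_on_upper[OF assms(1)] continuous_on_lower le out])
         (use lo up True in \<open>auto simp: squash_pos_iff\<close>)
    then show ?thesis using True by (simp add: cx hull_curve_def)
  next
    case False
    then have "upper a b p x < 0" using assms(6) up by (simp add: squash_neg_iff)
    then show ?thesis
      using graph_curve_not_inside[of "upper a b p" x 0 "lower \<mu> a b p"] lo False
      by (simp add: cx hull_curve_def)
  qed
qed

text \<open>Between its end points an upper graph lies above height -1/2 and a lower one below, so a
  mixed meeting would be a common end point of the two curves.\<close>

lemma hull_curve_common_point:
  assumes "0 < \<mu>" "a < b" "p a \<noteq> q a" "p b \<noteq> q b"
    and z: "z \<in> hull_curve \<mu> a b p" "z \<in> hull_curve \<mu> a b q"
  shows "p (Re z) = q (Re z) \<and> Im z = upper a b p (Re z) \<or>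
    lower \<mu> a b p (Re z) = lower \<mu> a b q (Re z) \<and> Im z = lower \<mu> a b p (Re z)"
proof -
  define x where "x = Re z"
  have x: "left a p \<le> x" "x \<le> right b p" "left a q \<le> x" "x \<le> right b q"
    and zp: "Im z = upper a b p x \<or> Im z = lower \<mu> a b p x"
    and zq: "Im z = upper a b q x \<or> Im z = lower \<mu> a b q x"
    using z by (simp_all add: hull_curve_def graph_curve_def x_def)
  note up = upper_ge[OF assms(2) x(1,2)] and up' = upper_ge[OF assms(2) x(3,4)]
    and lo = lower_le[OF assms(1) x(1,2)] and lo' = lower_le[OF assms(1) x(3,4)]
  \<comment> \<open>Left end points lie below \<open>a\<close> and right ones above
    \<open>b\<close>; two on the same side differ because \<open>p\<close> and \<open>q\<close>
    differ at \<open>a\<close> and at \<open>b\<close>.\<close>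
  have mixed: False if "x = left a p \<or> x = right b p" "x = left a q \<or> x = right b q"
    using that assms(2-4) left_bounds(2)[of a p] left_bounds(2)[of a q]
      right_bounds(1)[of b p] right_bounds(1)[of b q] by auto
  show ?thesis
  proof (cases "Im z = upper a b p x")
    case p: True
    show ?thesis
    proof (cases "Im z = upper a b q x")
      case True
      then have "squash (p (clamp_to a b x)) = squash (q (clamp_to a b x))"
        using p by (simp add: upper_def)
      then have c: "p (clamp_to a b x) = q (clamp_to a b x)" by simp
      \<comment> \<open>Since the functions differ at \<open>a\<close> and \<open>b\<close>, no
        clamping takes place and they agree at \<open>x\<close> itself.\<close>
      then have "clamp_to a b x \<noteq> a" "clamp_to a b x \<noteq> b" using assms(3,4) by auto
      then have "clamp_to a b x = x" by (auto simp: clamp_to_def max_def min_def split: if_splits)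
      with c p show ?thesis by (simp add: x_def)
    next
      case False
      with zq p up(1) lo'(1) have "upper a b p x = -1/2" "lower \<mu> a b q x = -1/2" by auto
      with up(2) lo'(2) mixed show ?thesis by blast
    qed
  next
    case False
    then have p: "Im z = lower \<mu> a b p x" using zp by simp
    show ?thesis
    proof (cases "Im z = lower \<mu> a b q x")
      case True
      then show ?thesis using p by (simp add: x_def)
    next
      case False
      with zq p up'(1) lo(1) have "upper a b q x = -1/2" "lower \<mu> a b p x = -1/2" by auto
      with up'(2) lo(2) mixed show ?thesis by blast
    qed
  qed
qed

text \<open>Upper graphs meet only where the functions agree; the extra 1 is for the lower
  parabolas.\<close>

lemma hull_curve_Int:
  assumes "0 < \<mu>" "a < b" "p a \<noteq> q a" "p b \<noteq> q b"
    and fin: "finite {x. p x = q x}" and card: "card {x. p x = q x} \<le> n"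
  shows "ecard (hull_curve \<mu> a b p \<inter> hull_curve \<mu> a b q) \<le> enat (n + 1)"
proof -
  let ?Z = "{x. p x = q x}"
  let ?Y = "{x. lower \<mu> a b p x = lower \<mu> a b q x}"
  define l r l' r' where lr: "l = left a p" "r = right b p" "l' = left a q" "r' = right b q"
  have ineq: "l \<noteq> l'" "r \<noteq> r'" "l < r'" "l' < r" "l < r" "l' < r'"
    using assms(2-4) left_bounds(2)[of a p] right_bounds(1)[of b p]
      left_bounds(2)[of a q] right_bounds(1)[of b q] unfolding lr left_inject right_inject by linarith+
  have sub: "hull_curve \<mu> a b p \<inter> hull_curve \<mu> a b q \<subseteq>
      (\<lambda>x. Complex x (upper a b p x)) ` ?Z \<union> (\<lambda>x. Complex x (lower \<mu> a b p x)) ` ?Y"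
    using hull_curve_common_point[OF assms(1-4)] by (force simp: complex_eq_iff image_iff)
  \<comment> \<open>With two meetings the affine difference of the parabolas would vanish, giving
    equal sums and products of roots and so a shared root set.\<close>
  have Y: "x = y" if "x \<in> ?Y" "y \<in> ?Y" for x y
  proof (rule ccontr)
    assume xy: "x \<noteq> y"
    have X: "(x - l) * (x - r) = (x - l') * (x - r')" and Y: "(y - l) * (y - r) = (y - l') * (y - r')"
      using that assms(1) unfolding lower_def lr by simp_all
    have "(x - y) * ((l' + r') - (l + r)) = 0"
      using X Y by algebra
    then have s: "l' + r' = l + r" using xy by simp
    then have m: "l' * r' = l * r"
    proof -
      have "l' * r' - l * r = x * ((l' + r') - (l + r))" using X by algebra
      then show ?thesis using s by simp
    qed
    \<comment> \<open>The quadratic with roots \<open>l'\<close> and \<open>r'\<close>, evaluated at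
      \<open>l\<close>.\<close>
    have "(l - l') * (l - r') = l * l - l * (l' + r') + l' * r'" by (simp add: algebra_simps)
    also have "\<dots> = 0" unfolding s m by (simp add: algebra_simps)
    finally have "l = l' \<or> l = r'" by simp
    then show False using ineq by linarith
  qed
  have finY: "finite ?Y"
  proof (cases "?Y = {}")
    case False
    then obtain y where "y \<in> ?Y" by blast
    with Y have "?Y \<subseteq> {y}" by blast
    then show ?thesis by (rule finite_subset) simp
  qed simp
  have "card ?Y \<le> Suc 0"
    unfolding card_le_Suc0_iff_eq[OF finY] using Y by blast
  let ?R = "(\<lambda>x. Complex x (upper a b p x)) ` ?Z \<union> (\<lambda>x. Complex x (lower \<mu> a b p x)) ` ?Y"
  have "finite ?R" using fin finY by blast
  moreover have "card ?R \<le> n + 1"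
    using card_Un_le[of "(\<lambda>x. Complex x (upper a b p x)) ` ?Z" "(\<lambda>x. Complex x (lower \<mu> a b p x)) ` ?Y"]
      card_image_le[OF fin, of "\<lambda>x. Complex x (upper a b p x)"]
      card_image_le[OF finY, of "\<lambda>x. Complex x (lower \<mu> a b p x)"] card \<open>card ?Y \<le> Suc 0\<close> by linarith
  ultimately show ?thesis
    using sub finite_subset[OF sub] card_mono[OF _ sub] by (simp add: ecard_def)
qed

section \<open>Fitting the curves into the top face\<close>

definition holed_disc :: "nat \<Rightarrow> complex set" where
  "holed_disc g = cball 0 (real g + 1) - (\<Union>j\<in>{1..g}. ball (of_nat j) (1/4))"

text \<open>Heights stay within 3/4 and abscissas within \<open>real g + 3/4\<close>, hence in the
  disc. Over a hole the upper graph is at least 1/4 away from the axis and the lower one at most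
  -1/2 high, so both miss the hole.\<close>

lemma hull_curve_subset_holed_disc:
  assumes g: "1 \<le> g" and a: "0 \<le> a" "a \<le> 1/2" and b: "real g + 1/4 \<le> b" "b \<le> real g + 1/2"
    and \<mu>: "\<mu> = 1 / (real g + 2)\<^sup>2"
    and p: "\<And>j x. j \<in> {1..g} \<Longrightarrow> \<bar>x - real j\<bar> < 1/4 \<Longrightarrow> 1 \<le> \<bar>p x\<bar>"
  shows "hull_curve \<mu> a b p \<subseteq> holed_disc g"
proof
  fix z assume z: "z \<in> hull_curve \<mu> a b p"
  define x y where xy: "x = Re z" "y = Im z"
  have "1 \<le> real g" using g by simp
  then have ab: "a < b" using a b by linarith
  have \<mu>0: "0 < \<mu>" using \<mu> by simp
  have x: "left a p \<le> x" "x \<le> right b p" and y: "y = upper a b p x \<or> y = lower \<mu> a b p x"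
    using z by (auto simp: hull_curve_def graph_curve_def xy)
  have xb: "-1/4 \<le> x" "x \<le> real g + 3/4"
    using x left_bounds[of a p] right_bounds[of b p] a b by linarith+
  have "-3/4 \<le> lower \<mu> a b p x"
  proof -
    define u v w where uvw: "u = x - left a p" "v = right b p - x" "w = real g + 2"
    have uv: "0 \<le> u" "0 \<le> v" "u + v \<le> w"
      using x left_bounds[of a p] right_bounds[of b p] a b unfolding uvw by linarith+
    \<comment> \<open>By the arithmetic-geometric mean inequality the parabola dips by at most a
      quarter of \<open>\<mu>\<close> times its squared width. As the width is at most
      \<open>w\<close>, the choice of \<open>\<mu>\<close> bounds the dip by 1/4.\<close>
    have "4 * (u * v) \<le> (u + v)\<^sup>2"
      using zero_le_power2[of "u - v"] by (simp add: power2_eq_square algebra_simps)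
    also have "\<dots> \<le> w\<^sup>2" using uv by (intro power_mono) auto
    finally have "\<mu> * (u * v) \<le> 1/4"
      unfolding \<mu> uvw(3)[symmetric] using uvw(3) by (simp add: field_simps)
    then show ?thesis unfolding lower_def uvw by (simp add: algebra_simps)
  qed
  moreover have lo: "lower \<mu> a b p x \<le> -1/2"
    by (rule lower_le(1)[OF \<mu>0 x])
  moreover have "-1/2 \<le> upper a b p x"
    by (rule upper_ge(1)[OF ab x])
  ultimately have "\<bar>y\<bar> \<le> 3/4" using y upper_less_half[of a b p x] by (auto simp: abs_le_iff)
  then have y2: "y\<^sup>2 \<le> (3/4)\<^sup>2" by (metis abs_ge_zero power2_abs power_mono)
  have "\<bar>x\<bar> \<le> real g + 3/4" using xb by (auto simp: abs_le_iff)
  then have "x\<^sup>2 \<le> (real g + 3/4)\<^sup>2" by (metis abs_ge_zero power2_abs power_mono)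
  with y2 have "(cmod z)\<^sup>2 \<le> (real g + 3/4)\<^sup>2 + (3/4)\<^sup>2"
    unfolding cmod_power2 xy by linarith
  \<comment> \<open>This reduces to \<open>1/8 \<le> real g / 2\<close>, which fails for
    \<open>g = 0\<close>.\<close>
  also have "\<dots> \<le> (real g + 1)\<^sup>2" using g by (simp add: power2_eq_square algebra_simps)
  finally have "cmod z \<le> real g + 1" by (rule power2_le_imp_le) simp
  moreover have "z \<notin> ball (of_nat j) (1/4)" if j: "j \<in> {1..g}" for j
  proof
    assume "z \<in> ball (of_nat j) (1/4)"
    then have d: "cmod (z - of_nat j) < 1/4" by (simp add: dist_norm norm_minus_commute)
    have dx: "\<bar>x - real j\<bar> < 1/4" and dy: "\<bar>y\<bar> < 1/4"
      using abs_Re_le_cmod[of "z - of_nat j"] abs_Im_le_cmod[of "z - of_nat j"] d by (auto simp: xy)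
    have "real j \<ge> 1" "real j \<le> real g" using j by auto
    \<comment> \<open>The bounds on \<open>a\<close> and \<open>b\<close> place every hole over
      \<open>[a, b]\<close>, where nothing is clamped.\<close>
    then have "a \<le> x" "x \<le> b" using dx a b unfolding abs_less_iff by linarith+
    then have "upper a b p x = squash (p x)" by simp
    with abs_squash_ge[OF p[OF j dx]] dy y lo show False by auto
  qed
  ultimately show "z \<in> holed_disc g" by (auto simp: holed_disc_def)
qed

section \<open>Systems of curves on the surface\<close>

lemma holed_disc_subset_frontier:
  assumes "z \<in> holed_disc g" shows "(z, 1) \<in> frontier (handlebody g)"
proof -
  have hb: "handlebody g = holed_disc g \<times> {-1..1}"
    by (simp add: handlebody_def holed_disc_def)
  have "(z, 1) \<in> handlebody g" using assms by (simp add: hb)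
  then have "(z, 1) \<in> closure (handlebody g)" using closure_subset by blast
  moreover have "(z, 1) \<notin> interior (handlebody g)"
    by (simp add: hb interior_Times)
  ultimately show ?thesis by (simp add: frontier_def)
qed

text \<open>The handlebody is closed, so its frontier stays outside the open holes; projecting the
  surface thus lands in the plane punctured at any centre.\<close>

lemma frontier_handlebody_avoids_centres:
  assumes "w \<in> frontier (handlebody g)" "j \<in> {1..g}" shows "fst w \<noteq> of_nat j"
proof -
  have "closed (cball 0 (real g + 1) - (\<Union>j\<in>{1..g}. ball (of_nat j) (1/4)) :: complex set)"
    by (intro closed_Diff) auto
  then have "closed (handlebody g)" unfolding handlebody_def by (intro closed_Times) auto
  then have "w \<in> handlebody g" using assms(1) frontier_subset_closed by blast
  then have "fst w \<notin> ball (of_nat j) (1/4)" using assms(2) by (auto simp: handlebody_def)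
  then show ?thesis by auto
qed

lemma ecard_image: "inj_on f A \<Longrightarrow> ecard (f ` A) = ecard A"
  by (simp add: ecard_def finite_image_iff card_image)

text \<open>Reduces the problem to functions on the line: \<open>pos\<close> yields an enclosed
  centre, so each curve is essential; \<open>sep\<close> yields a centre enclosed by just one of two
  curves, so they are not homotopic; the strict bound in \<open>card\<close> leaves room for one
  meeting of the lower parabolas.\<close>

lemma hull_curves_k_system:
  fixes p :: "'i \<Rightarrow> real \<Rightarrow> real"
  assumes X: "closed_orientable_surface g X" and g: "1 \<le> g" and I: "finite I"
    and cont: "\<And>i. i \<in> I \<Longrightarrow> continuous_on UNIV (p i)"
    and big: "\<And>i j x. i \<in> I \<Longrightarrow> j \<in> {1..g} \<Longrightarrow> \<bar>x - real j\<bar> < 1/4 \<Longrightarrow> 1 \<le> \<bar>p i x\<bar>"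
    and fin: "\<And>i i'. i \<in> I \<Longrightarrow> i' \<in> I \<Longrightarrow> i \<noteq> i' \<Longrightarrow> finite {x. p i x = p i' x}"
    and card: "\<And>i i'. i \<in> I \<Longrightarrow> i' \<in> I \<Longrightarrow> i \<noteq> i' \<Longrightarrow> card {x. p i x = p i' x} < k"
    and pos: "\<And>i. i \<in> I \<Longrightarrow> \<exists>j\<in>{1..g}. 0 < p i (real j)"
    and sep: "\<And>i i'. i \<in> I \<Longrightarrow> i' \<in> I \<Longrightarrow> i \<noteq> i' \<Longrightarrow>
      \<exists>j\<in>{1..g}. (0 < p i (real j)) \<noteq> (0 < p i' (real j))"
  shows "\<exists>\<Omega>. k_system k X \<Omega> \<and> finite \<Omega> \<and> card \<Omega> = card I"
proof -
  \<comment> \<open>For \<open>a\<close> and \<open>b\<close> outside this finite set all end points of the curves are distinct.\<close>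
  define B where "B = (\<Union>(i, i')\<in>{(i, i'). i \<in> I \<and> i' \<in> I \<and> i \<noteq> i'}. {x. p i x = p i' x})"
  have "{(i, i'). i \<in> I \<and> i' \<in> I \<and> i \<noteq> i'} \<subseteq> I \<times> I" by auto
  then have "finite {(i, i'). i \<in> I \<and> i' \<in> I \<and> i \<noteq> i'}"
    using I finite_subset by blast
  then have finB: "finite B" unfolding B_def using fin by auto
  have generic: "\<exists>x\<in>{u<..<v}. x \<notin> B" if "u < v" for u v :: real
    using that finB by (metis infinite_Ioo finite_subset subsetI)
  obtain a where a: "0 < a" "a < 1/2" "a \<notin> B"
    using generic[of 0 "1/2"] by auto
  obtain b where b: "real g + 1/4 < b" "b < real g + 1/2" "b \<notin> B"
    using generic[of "real g + 1/4" "real g + 1/2"] by auto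
  have B: "p i x \<noteq> p i' x" if "x \<notin> B" "i \<in> I" "i' \<in> I" "i \<noteq> i'" for x i i'
    using that unfolding B_def by auto
  have "1 \<le> real g" using g by simp
  then have ab: "a < b" using a b by linarith
  define \<mu> where "\<mu> = 1 / (real g + 2)\<^sup>2"
  have \<mu>: "0 < \<mu>" by (simp add: \<mu>_def)
  define H where "H i = hull_curve \<mu> a b (p i)" for i
  have HP: "H i \<subseteq> holed_disc g" if "i \<in> I" for i
    unfolding H_def using a b
    by (intro hull_curve_subset_holed_disc[OF g]) (auto simp: \<mu>_def intro: big[OF that])
  have inside: "of_nat j \<in> inside (H i) \<longleftrightarrow> 0 < p i (real j)" if "i \<in> I" "j \<in> {1..g}" for i j
  proof -
    have "1 \<le> real j" "real j \<le> real g" using that by auto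
    then have "a \<le> real j" "real j \<le> b" using a b by linarith+
    moreover have "p i (real j) \<noteq> 0" using big[OF that, of "real j"] by auto
    ultimately show ?thesis
      using hull_curve_inside_iff[OF cont[OF that(1)] \<mu> ab, of "real j"] by (simp add: H_def)
  qed
  let ?F = "frontier (handlebody g)"
  obtain \<eta> \<xi> where "homeomorphic_maps X (top_of_set ?F) \<eta> \<xi>"
    using X by (auto simp: closed_orientable_surface_def homeomorphic_space_def)
  then have \<eta>: "continuous_map X (top_of_set ?F) \<eta>" and \<xi>: "continuous_map (top_of_set ?F) X \<xi>"
    and \<eta>\<xi>: "\<And>w. w \<in> ?F \<Longrightarrow> \<eta> (\<xi> w) = w"
    by (auto simp: homeomorphic_maps_def)
  \<comment> \<open>\<open>m\<close> puts the holed disc on the top face and \<open>q\<close>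
    projects the surface to the plane; as a left inverse of \<open>m\<close> there, \<open>q\<close>
    is injective on each curve.\<close>
  define q where "q = fst \<circ> \<eta>"
  define m where "m z = \<xi> (z, 1)" for z :: complex
  have qm: "q (m z) = z" if "z \<in> holed_disc g" for z
    using \<eta>\<xi>[OF holed_disc_subset_frontier[OF that]] by (simp add: q_def m_def)
  then have injm: "inj_on m (holed_disc g)" by (rule inj_on_inverseI)
  have cm: "continuous_map (top_of_set (holed_disc g)) X m"
  proof -
    have "continuous_map (top_of_set (holed_disc g)) (top_of_set ?F) (\<lambda>z. (z, 1))"
      using holed_disc_subset_frontier by (auto intro!: continuous_intros)
    from continuous_map_compose[OF this \<xi>] show ?thesis by (simp add: m_def[abs_def] comp_def)
  qed
  have cq: "continuous_map X (top_of_set (- {of_nat j})) q" if "j \<in> {1..g}" for j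
  proof -
    have "continuous_map (top_of_set ?F) (top_of_set (- {of_nat j})) fst"
      using frontier_handlebody_avoids_centres[OF _ that] by (force intro!: continuous_intros)
    from continuous_map_compose[OF \<eta> this] show ?thesis by (simp add: q_def)
  qed
  define c where "c i = m ` H i" for i
  have qc: "q ` c i = H i" if "i \<in> I" for i
    using HP[OF that] qm by (force simp: c_def)
  have injq: "inj_on q (c i)" if "i \<in> I" for i
    using HP[OF that] qm by (intro inj_on_inverseI[of _ m]) (auto simp: c_def subset_iff)
  \<comment> \<open>In a Hausdorff space a continuous injection of the compact circle is an
    embedding.\<close>
  have haus: "Hausdorff_space X"
    using X homeomorphic_Hausdorff_space[of X "top_of_set ?F"]
    by (simp add: closed_orientable_surface_def Hausdorff_space_subtopology)
  have scc: "simple_closed_curve X (c i)" if i: "i \<in> I" for i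
  proof -
    obtain f :: "complex \<Rightarrow> complex" where f: "continuous_on (sphere 0 1) f"
      "inj_on f (sphere 0 1)" "f ` sphere 0 1 = H i"
      unfolding H_def by (rule hull_curve_parametrization[OF cont[OF i] \<mu> ab])
    have "continuous_map circle (top_of_set (holed_disc g)) f"
      using f HP[OF i] by auto
    from continuous_map_compose[OF this cm] have "continuous_map circle X (m \<circ> f)" .
    moreover have "inj_on (m \<circ> f) (sphere 0 1)"
      using f HP[OF i] injm by (auto intro: comp_inj_on inj_on_subset)
    ultimately have "embedding_map circle X (m \<circ> f)"
      by (intro continuous_imp_embedding_map haus) (auto simp: compact_space_subtopology)
    moreover have "(m \<circ> f) ` sphere 0 1 = c i" using f(3) by (metis c_def image_comp)
    ultimately show ?thesis unfolding simple_closed_curve_def parametrizes_def by blast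
  qed
  have ess: "essential X (c i)" if i: "i \<in> I" for i
  proof -
    obtain j where j: "j \<in> {1..g}" "0 < p i (real j)" using pos[OF i] by blast
    then show ?thesis
      using homotopically_trivial_not_inside[OF cq[OF j(1)] injq[OF i]] inside[OF i j(1)] qc[OF i]
      by (auto simp: essential_def)
  qed
  have nonhom: "\<not> homotopic_curves X (c i) (c i')" if i: "i \<in> I" "i' \<in> I" "i \<noteq> i'" for i i'
  proof -
    obtain j where j: "j \<in> {1..g}" "(0 < p i (real j)) \<noteq> (0 < p i' (real j))"
      using sep[OF i] by blast
    then show ?thesis
      using homotopic_curves_inside_iff[OF cq[OF j(1)] injq[OF i(1)] injq[OF i(2)]]
        inside[OF i(1) j(1)] inside[OF i(2) j(1)] qc[OF i(1)] qc[OF i(2)] by auto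
  qed
  have int: "geometric_intersection X (c i) (c i') \<le> enat k" if i: "i \<in> I" "i' \<in> I" "i \<noteq> i'" for i i'
  proof -
    have "geometric_intersection X (c i) (c i') \<le> ecard (c i \<inter> c i')"
      by (rule geometric_intersection_le_ecard[OF scc[OF i(1)] scc[OF i(2)]])
    also have "c i \<inter> c i' = m ` (H i \<inter> H i')"
      unfolding c_def using inj_on_image_Int[OF injm HP[OF i(1)] HP[OF i(2)]] by simp
    also have "ecard \<dots> = ecard (H i \<inter> H i')"
      using HP[OF i(1)] by (intro ecard_image inj_on_subset[OF injm]) auto
    also have "\<dots> \<le> enat (card {x. p i x = p i' x} + 1)"
      unfolding H_def
      by (rule hull_curve_Int[OF \<mu> ab B[OF a(3) i] B[OF b(3) i] fin[OF i]]) simp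
    also have "\<dots> \<le> enat k" using card[OF i] by simp
    finally show ?thesis .
  qed
  \<comment> \<open>Equal sets would be homotopic by reflexivity, so distinct indices give distinct
    curves.\<close>
  have "inj_on c I"
    using nonhom homotopic_curves_refl[OF scc] by (metis inj_onI)
  then have "card (c ` I) = card I" by (rule card_image)
  moreover have "k_system k X (c ` I)"
    unfolding k_system_def pairwise_def using scc ess nonhom int by blast
  ultimately show ?thesis using I by blast
qed

section \<open>Polynomials with prescribed sign changes\<close>

text \<open>Gap \<open>p\<close> is marked by the midpoint between \<open>p\<close> and
  \<open>p + 1\<close>. The factor 4 offsets the distance 1/4 from the holes, and the sign makes the
  value negative to the right of all marks.\<close>

definition hull_poly :: "nat set \<Rightarrow> real \<Rightarrow> real" where
  "hull_poly T x = - (\<Prod>p\<in>T. 4 * (x - (real p + 1/2)))"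

lemma continuous_on_hull_poly: "continuous_on A (hull_poly T)"
  unfolding hull_poly_def by (intro continuous_intros)

text \<open>A half-integer is more than 1/4 away from \<open>x\<close>, so each factor has absolute
  value at least 1.\<close>

lemma abs_hull_poly_ge:
  assumes "\<bar>x - real j\<bar> < 1/4" shows "1 \<le> \<bar>hull_poly T x\<bar>"
proof -
  have "1 \<le> \<bar>4 * (x - (real p + 1/2))\<bar>" for p
  proof (cases "p < j")
    case True
    then have "real p + 1 \<le> real j" by linarith
    then have "1/4 \<le> x - (real p + 1/2)" using assms unfolding abs_less_iff by linarith
    then show ?thesis by simp
  next
    case False
    then have "real j \<le> real p" by linarith
    then have "x - (real p + 1/2) \<le> - 1/4" using assms unfolding abs_less_iff by linarith
    then show ?thesis by simp
  qed
  then have "1 \<le> (\<Prod>p\<in>T. \<bar>4 * (x - (real p + 1/2))\<bar>)" by (intro prod_ge_1)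
  then show ?thesis by (simp add: hull_poly_def abs_prod)
qed

text \<open>The negative factors are those with \<open>p \<ge> m\<close>; the leading minus sign
  turns even into odd.\<close>

lemma hull_poly_pos_iff:
  assumes "finite T" shows "0 < hull_poly T (real m) \<longleftrightarrow> odd (card {p\<in>T. m \<le> p})"
proof -
  let ?Q = "\<lambda>T. \<Prod>p\<in>T. 4 * (real m - (real p + 1/2))"
  have "?Q T \<noteq> 0 \<and> (0 < ?Q T \<longleftrightarrow> even (card {p\<in>T. m \<le> p}))"
    using assms
  proof (induction T rule: finite_induct)
    case empty
    then show ?case by simp
  next
    case (insert q T)
    have n: "4 * (real m - (real q + 1/2)) \<noteq> 0" "0 < 4 * (real m - (real q + 1/2)) \<longleftrightarrow> q < m"
    proof -
      have "q < m \<and> real q + 1 \<le> real m \<or> \<not> q < m \<and> real m \<le> real q"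
        using of_nat_le_iff[of "Suc q" m, where 'a = real] by auto
      then show "4 * (real m - (real q + 1/2)) \<noteq> 0" "0 < 4 * (real m - (real q + 1/2)) \<longleftrightarrow> q < m"
        by auto
    qed
    have "{p \<in> insert q T. m \<le> p} = (if m \<le> q then insert q {p\<in>T. m \<le> p} else {p\<in>T. m \<le> p})"
      by auto
    then have even: "even (card {p \<in> insert q T. m \<le> p}) \<longleftrightarrow> (q < m \<longleftrightarrow> even (card {p\<in>T. m \<le> p}))"
      using insert.hyps by (cases "m \<le> q") (simp_all add: not_le not_less)
    have Q: "?Q (insert q T) = 4 * (real m - (real q + 1/2)) * ?Q T"
      using insert.hyps by (rule prod.insert)
    have sign: "u * v \<noteq> 0 \<and> (0 < u * v \<longleftrightarrow> (0 < u \<longleftrightarrow> 0 < v))" if "u \<noteq> 0" "v \<noteq> 0" for u v :: real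
      using that by (auto simp: zero_less_mult_iff)
    note s = sign[OF n(1) conjunct1[OF insert.IH]]
    show ?case
      unfolding Q even s[THEN conjunct2] n(2) conjunct2[OF insert.IH]
      by (rule conjI[OF s[THEN conjunct1] refl])
  qed
  moreover have "0 < - u \<longleftrightarrow> \<not> E" if "u \<noteq> 0 \<and> (0 < u \<longleftrightarrow> E)" for u :: real and E
    using that by auto
  ultimately show ?thesis unfolding hull_poly_def by blast
qed

text \<open>Equal degrees and leading coefficients cancel, so the difference has degree below
  \<open>card T\<close>; it is nonzero because some root for \<open>T\<close> is not one for
  \<open>T'\<close>.\<close>

lemma hull_poly_eq_points:
  assumes "finite T" "finite T'" "card T = card T'" "T \<noteq> T'"
  shows "finite {x. hull_poly T x = hull_poly T' x}"
    and "card {x. hull_poly T x = hull_poly T' x} < card T"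
proof -
  \<comment> \<open>Coefficients start with the constant one, and the minus sign of
    \<open>hull_poly\<close> is dropped.\<close>
  define P where "P T = (\<Prod>p\<in>T. [:- (4 * real p + 2), 4:])" for T
  have poly: "poly (P T) x = - hull_poly T x" for T x
    by (simp add: P_def hull_poly_def poly_prod algebra_simps)
  have deg: "degree (P T) = card T" for T
    unfolding P_def by (subst degree_prod_eq_sum_degree) auto
  have lead: "lead_coeff (P T) = 4 ^ card T" for T
    unfolding P_def lead_coeff_prod by simp
  have "\<not> T \<subseteq> T'" using assms card_subset_eq by metis
  then obtain q where q: "q \<in> T" "q \<notin> T'" by blast
  have "hull_poly T (real q + 1/2) = 0" using q(1) assms(1) by (auto simp: hull_poly_def)
  moreover have "hull_poly T' (real q + 1/2) \<noteq> 0" using q(2) assms(2) by (auto simp: hull_poly_def)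
  ultimately have nz: "P T - P T' \<noteq> 0"
    using poly[of T "real q + 1/2"] poly[of T' "real q + 1/2"] by (metis eq_iff_diff_eq_0 neg_equal_0_iff_equal)
  have eq: "{x. hull_poly T x = hull_poly T' x} = {x. poly (P T - P T') x = 0}"
    by (auto simp: poly)
  have "coeff (P T - P T') (card T) = 0"
    using lead[of T] lead[of T'] deg assms(3) by simp
  moreover have "degree (P T - P T') \<le> card T"
    using degree_diff_le[of "P T" "card T" "P T'"] deg assms(3) by simp
  ultimately have "degree (P T - P T') < card T"
    using nz by (metis leading_coeff_0_iff order_le_imp_less_or_eq)
  then show "card {x. hull_poly T x = hull_poly T' x} < card T"
    unfolding eq using card_poly_roots_bound[OF nz] by linarith
  show "finite {x. hull_poly T x = hull_poly T' x}"
    unfolding eq by (rule poly_roots_finite[OF nz])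
qed

text \<open>Exactly one gap is at or beyond \<open>Max T\<close>, an odd number. Two elements force
  \<open>Max T\<close> to be positive, hence the index of a hole.\<close>

lemma hull_poly_exists_pos:
  assumes "T \<subseteq> {0..g}" "2 \<le> card T"
  shows "\<exists>j\<in>{1..g}. 0 < hull_poly T (real j)"
proof -
  have fin: "finite T" using assms finite_subset by blast
  have ne: "T \<noteq> {}" using assms by auto
  have M: "Max T \<in> T" by (rule Max_in[OF fin ne])
  have "Max T \<noteq> 0"
  proof
    assume "Max T = 0"
    then have "T \<subseteq> {0}" using Max_ge[OF fin] by force
    then have "card T \<le> 1" using card_mono[of "{0::nat}" T] by simp
    then show False using assms by simp
  qed
  moreover have "{p\<in>T. Max T \<le> p} = {Max T}" using M Max_ge[OF fin] by force
  then have "0 < hull_poly T (real (Max T))" by (simp add: hull_poly_pos_iff[OF fin])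
  ultimately show ?thesis using M assms by (intro bexI[of _ "Max T"]) auto
qed

text \<open>The hole right before the last gap at which the two sets differ separates them.\<close>

lemma hull_poly_separate:
  assumes "T \<subseteq> {0..g}" "T' \<subseteq> {0..g}" "card T = card T'" "T \<noteq> T'"
  shows "\<exists>j\<in>{1..g}. (0 < hull_poly T (real j)) \<noteq> (0 < hull_poly T' (real j))"
proof -
  have fin: "finite T" "finite T'" using assms finite_subset by blast+
  define D where "D = (T - T') \<union> (T' - T)"
  \<comment> \<open>Equal cardinality gives elements on both sides of the difference, so its maximum
    is not 0, where there is no hole.\<close>
  have "\<not> T \<subseteq> T'" "\<not> T' \<subseteq> T" using assms fin card_subset_eq by metis+
  then obtain u v where uv: "u \<in> T - T'" "v \<in> T' - T" by blast
  have finD: "finite D" using fin by (simp add: D_def)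
  define m where "m = Max D"
  have mD: "m \<in> D" unfolding m_def using uv by (intro Max_in finD) (auto simp: D_def)
  have le: "p \<le> m" if "p \<in> D" for p unfolding m_def using that by (intro Max_ge finD)
  have "u \<in> D" "v \<in> D" "u \<noteq> v" using uv by (auto simp: D_def)
  then have "m \<noteq> 0" using le[of u] le[of v] by auto
  then have m: "m \<in> {1..g}" using mD assms(1,2) by (auto simp: D_def)
  \<comment> \<open>Beyond \<open>m\<close> the sets agree, and \<open>m\<close> lies in exactly one
    of them, so the two counts have different parity.\<close>
  define C where "C = {p\<in>T. m < p}"
  have C': "C = {p\<in>T'. m < p}" using le unfolding C_def D_def by force
  have "{p\<in>S. m \<le> p} = (if m \<in> S then insert m {p\<in>S. m < p} else {p\<in>S. m < p})" for S
    by (auto simp: order_le_less)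
  then have card: "card {p\<in>S. m \<le> p} = (if m \<in> S then 1 else 0) + card {p\<in>S. m < p}" if "finite S" for S
    using that by simp
  have "m \<in> T \<longleftrightarrow> m \<notin> T'" using mD by (auto simp: D_def)
  then have "odd (card {p\<in>T. m \<le> p}) \<noteq> odd (card {p\<in>T'. m \<le> p})"
    unfolding card[OF fin(1)] card[OF fin(2)] C_def[symmetric] C'[symmetric] by auto
  then show ?thesis using m by (intro bexI[of _ m]) (simp_all add: hull_poly_pos_iff fin)
qed

section \<open>Order of growth and choice of the parameters\<close>

lemma binomial_Suc_over_power_tendsto:
  "(\<lambda>n. real (Suc n choose t) / real n ^ t) \<longlonglongrightarrow> 1 / fact t"
proof -
  \<comment> \<open>For positive \<open>n\<close> the quotient is this product of the factors
    \<open>(n + 1 - i) / n\<close> over \<open>fact t\<close>, and each factor tends to 1.\<close>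
  have "(\<lambda>n. (\<Prod>i = 0..<t. 1 + (1 - real i) / real n) / fact t) \<longlonglongrightarrow> (\<Prod>i = 0..<t. 1 + 0) / fact t"
    by (intro tendsto_intros lim_const_over_n) auto
  then have lim: "(\<lambda>n. (\<Prod>i = 0..<t. 1 + (1 - real i) / real n) / fact t) \<longlonglongrightarrow> 1 / fact t"
    by simp
  have "(\<Prod>i = 0..<t. 1 + (1 - real i) / real n) / fact t = real (Suc n choose t) / real n ^ t"
    if "n > 0" for n
  proof -
    have "(\<Prod>i = 0..<t. 1 + (1 - real i) / real n) = (\<Prod>i = 0..<t. (real (Suc n) - real i) / real n)"
      using that by (intro prod.cong) (auto simp: field_simps)
    also have "\<dots> = (\<Prod>i = 0..<t. real (Suc n) - real i) / real n ^ t"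
      by (simp add: prod_dividef)
    finally show ?thesis by (simp add: binomial_gbinomial gbinomial_prod_rev)
  qed
  then have "\<forall>\<^sub>F n in sequentially. (\<Prod>i = 0..<t. 1 + (1 - real i) / real n) / fact t =
      real (Suc n choose t) / real n ^ t"
    by (intro eventually_sequentiallyI[of 1]) auto
  from Lim_transform_eventually[OF lim this] show ?thesis .
qed

theorem theorem1p2:
  fixes k :: nat and S :: "nat \<Rightarrow> 'a topology"
  assumes "k \<ge> 2"
    and "\<And>g. g \<ge> 1 \<Longrightarrow> closed_orientable_surface g (S g)"
  shows "\<exists>\<Omega> :: nat \<Rightarrow> 'a set set.
           (\<forall>g\<ge>1. k_system k (S g) (\<Omega> g) \<and> finite (\<Omega> g) \<and>
                   card (\<Omega> g) \<ge> g choose (1 + k div 2)) \<and>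
           is_Theta (\<lambda>g. real (card (\<Omega> g))) (\<lambda>g. real g ^ ((k + 1) div 2 + 1))"
proof -
  define t where "t = (k + 1) div 2 + 1"
  \<comment> \<open>The first bound lets every set enclose a hole, the second keeps fewer than
    \<open>k\<close> meetings of upper graphs; for \<open>k = 1\<close> the second would
    fail.\<close>
  have t: "2 \<le> t" "t \<le> k" using assms(1) unfolding t_def by presburger+
  have "\<exists>\<Omega>. k_system k (S g) \<Omega> \<and> finite \<Omega> \<and> card \<Omega> = Suc g choose t" if g: "1 \<le> g" for g
  proof -
    let ?I = "{T. T \<subseteq> {0..g} \<and> card T = t}"
    have "card ?I = Suc g choose t" by (simp add: n_subsets)
    moreover have "\<exists>\<Omega>. k_system k (S g) \<Omega> \<and> finite \<Omega> \<and> card \<Omega> = card ?I"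
    proof (rule hull_curves_k_system[OF assms(2)[OF g] g, where p = hull_poly])
      show "finite ?I" by simp
      show "continuous_on UNIV (hull_poly T)" for T by (rule continuous_on_hull_poly)
      show "1 \<le> \<bar>hull_poly T x\<bar>" if "\<bar>x - real j\<bar> < 1/4" for T j x
        by (rule abs_hull_poly_ge[OF that])
      fix T assume T: "T \<in> ?I"
      show "\<exists>j\<in>{1..g}. 0 < hull_poly T (real j)"
        using T t by (intro hull_poly_exists_pos) auto
      fix T' assume T': "T' \<in> ?I" and ne: "T \<noteq> T'"
      have fin: "finite T" "finite T'" using T T' finite_subset by blast+
      show "finite {x. hull_poly T x = hull_poly T' x}"
        using T T' ne by (intro hull_poly_eq_points fin) auto
      show "card {x. hull_poly T x = hull_poly T' x} < k"
        using T T' hull_poly_eq_points(2)[OF fin _ ne] t by auto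
      show "\<exists>j\<in>{1..g}. (0 < hull_poly T (real j)) \<noteq> (0 < hull_poly T' (real j))"
        using T T' ne by (intro hull_poly_separate) auto
    qed
    ultimately show ?thesis by simp
  qed
  then obtain \<Omega> where \<Omega>: "\<And>g. 1 \<le> g \<Longrightarrow> k_system k (S g) (\<Omega> g) \<and> finite (\<Omega> g) \<and> card (\<Omega> g) = Suc g choose t"
    by metis
  \<comment> \<open>For either parity of \<open>k\<close> the left side is one of the two summands
    of \<open>Suc g choose t\<close> in Pascal's rule.\<close>
  have "g choose (1 + k div 2) \<le> Suc g choose t" for g
  proof (cases "even k")
    case True
    then have "t = Suc (k div 2)" by (auto simp: t_def)
    then show ?thesis by simp
  next
    case False
    then have "t = Suc (Suc (k div 2))" by (auto simp: t_def elim!: oddE)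
    then show ?thesis by simp
  qed
  moreover have "is_Theta (\<lambda>g. real (card (\<Omega> g))) (\<lambda>g. real g ^ t)"
    unfolding is_Theta_def
  proof (intro exI conjI)
    show "0 < 1 / (fact t :: real)" by simp
    \<comment> \<open>\<open>\<Omega> 0\<close> is unspecified, so the quotients are compared from 1
      on.\<close>
    have "\<forall>\<^sub>F g in sequentially. real (Suc g choose t) / real g ^ t = real (card (\<Omega> g)) / real g ^ t"
      using \<Omega> by (intro eventually_sequentiallyI[of 1]) auto
    then show "(\<lambda>g. real (card (\<Omega> g)) / real g ^ t) \<longlonglongrightarrow> 1 / fact t"
      by (rule Lim_transform_eventually[OF binomial_Suc_over_power_tendsto])
  qed
  ultimately show ?thesis using \<Omega> by (intro exI[of _ \<Omega>]) (auto simp: t_def)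
qed

end
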